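(* Let $X_1,\dots,X_n$ be independent random points, each uniformly distributed on $[0,1]^2$, and let \[ C_n = \min_{F \subseteq [0,1]^2,\ F \text{ finite, nonempty}} \; |F| + \sum_{i=1}^n \min_{f\in F}\|X_i-f\|. \] Then $\mathbb{E}[C_n] = \Theta(n^{2/3})$, i.e., there are constants $c, C>0$ such that $c\, n^{2/3} \le \mathbb{E}[C_n] \le C\, n^{2/3}$ for all sufficiently large $n$.
   Context: $\|\cdot\|$ is the Euclidean norm on $\mathbb{R}^2$. *)

theory Defs
  imports "HOL-Probability.Probability"
begin

definition unit_square :: "(real ^ 2) set" where
  "unit_square = cbox 0 1"

definition facility_cost :: "nat \<Rightarrow> (nat \<Rightarrow> real ^ 2) \<Rightarrow> (real ^ 2) set \<Rightarrow> real" where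
  "facility_cost n x F = real (card F) + (\<Sum>i = 1..n. Min ((\<lambda>f. norm (x i - f)) ` F))"

definition facility_sets :: "(real ^ 2) set set" where
  "facility_sets = {F. F \<subseteq> unit_square \<and> finite F \<and> F \<noteq> {}}"

text \<open>The infimum is a minimum, see \<open>min_facility_cost_attained\<close> below.\<close>

definition min_facility_cost :: "nat \<Rightarrow> (nat \<Rightarrow> real ^ 2) \<Rightarrow> real" where
  "min_facility_cost n x = (INF F \<in> facility_sets. facility_cost n x F)"

lemma continuous_on_Min_lessThan:
  fixes h :: "nat \<Rightarrow> 'a::topological_space \<Rightarrow> real"
  assumes "\<And>j. continuous_on S (h j)"
  shows "continuous_on S (\<lambda>g. Min ((\<lambda>j. h j g) ` {..<Suc k}))"
proof (induction k)
  case 0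
  then show ?case using assms[of 0] by (simp add: lessThan_Suc)
next
  case (Suc k)
  have "Min ((\<lambda>j. h j g) ` {..<Suc (Suc k)}) = min (h (Suc k) g) (Min ((\<lambda>j. h j g) ` {..<Suc k}))" for g
    by (subst lessThan_Suc, subst image_insert, rule Min_insert) auto
  then show ?case using Suc assms by (simp only:) (intro continuous_intros)
qed

lemma min_facility_cost_attained:
  "\<exists>F \<in> facility_sets. facility_cost n x F = min_facility_cost n x \<and>
     (\<forall>F' \<in> facility_sets. facility_cost n x F \<le> facility_cost n x F')"
proof -
  define P where "P = (\<Pi>\<^sub>E j\<in>(UNIV::nat set). unit_square)"
  define G where "G = (\<lambda>k g. real (Suc k) + (\<Sum>i = 1..n. Min ((\<lambda>j. norm (x i - g j)) ` {..<Suc k})))"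
  have zero: "0 \<in> unit_square"
    by (simp add: unit_square_def mem_box_cart)
  have "compactin (product_topology (\<lambda>j::nat. euclidean) UNIV) P"
    unfolding P_def compactin_PiE by (simp add: unit_square_def)
  then have "compact P"
    by (simp add: euclidean_product_topology)
  moreover have "P \<noteq> {}"
    using zero by (auto simp: P_def PiE_eq_empty_iff)
  moreover have "continuous_on P (G k)" for k
    unfolding G_def
    by (intro continuous_intros continuous_on_Min_lessThan continuous_on_subset[OF continuous_on_product_coordinates]) auto
  ultimately have "\<forall>k. \<exists>g\<in>P. \<forall>g'\<in>P. G k g \<le> G k g'"
    using continuous_attains_inf by blast
  then obtain g where gP: "\<And>k. g k \<in> P" and gmin: "\<And>k g'. g' \<in> P \<Longrightarrow> G k (g k) \<le> G k g'"
    by metis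
  have Gge: "real (Suc k) \<le> G k g'" for k g'
  proof -
    have "0 \<le> Min ((\<lambda>j. norm (x i - g' j)) ` {..<Suc k})" for i
      by (subst Min_ge_iff) auto
    then show ?thesis
      unfolding G_def by (simp add: sum_nonneg)
  qed
  define m where "m = (\<lambda>k. G k (g k))"
  obtain K :: nat where K: "m 0 < real K"
    using reals_Archimedean2 by blast
  obtain k where k: "k \<in> {..K}" "\<And>l. l \<in> {..K} \<Longrightarrow> m k \<le> m l"
    using arg_min_if_finite[of "{..K}" m] by (metis atMost_iff finite_atMost atMost_iff empty_iff le0 linorder_not_less)
  have kmin: "m k \<le> m l" for l
  proof (cases "l \<le> K")
    case False
    have "m k \<le> m 0" using k(2)[of 0] by simp
    also have "\<dots> \<le> real (Suc l)" using K False by simp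
    also have "\<dots> \<le> m l" using Gge by (simp add: m_def)
    finally show ?thesis .
  qed (use k in simp)
  define F where "F = g k ` {..<Suc k}"
  have F: "F \<in> facility_sets"
    using gP[of k] by (auto simp: F_def facility_sets_def P_def PiE_iff)
  have "card F \<le> Suc k"
    using card_image_le[of "{..<Suc k}" "g k"] by (simp add: F_def)
  then have Fle: "facility_cost n x F \<le> m k"
    by (simp add: facility_cost_def m_def G_def F_def image_image)
  have opt: "facility_cost n x F \<le> facility_cost n x F'" if F': "F' \<in> facility_sets" for F'
  proof -
    have fin: "finite F'" "F' \<noteq> {}" "F' \<subseteq> unit_square"
      using F' by (auto simp: facility_sets_def)
    then obtain l where l: "card F' = Suc l"
      by (metis card_eq_0_iff not0_implies_Suc)
    obtain b where b: "bij_betw b {..<Suc l} F'"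
      using ex_bij_betw_nat_finite[OF fin(1)] l by (auto simp: atLeast0LessThan)
    define g' where "g' = (\<lambda>j. if j < Suc l then b j else 0)"
    have im: "g' ` {..<Suc l} = F'"
      using b by (auto simp: g'_def bij_betw_def)
    have "g' j \<in> unit_square" for j
    proof (cases "j < Suc l")
      case True
      then show ?thesis using im fin(3) by blast
    qed (use zero in \<open>simp add: g'_def\<close>)
    then have "g' \<in> P"
      by (simp add: P_def PiE_iff)
    have "(\<lambda>j. norm (x i - g' j)) ` {..<Suc l} = (\<lambda>f. norm (x i - f)) ` F'" for i
      unfolding im[symmetric] image_image ..
    then have "G l g' = facility_cost n x F'"
      by (simp only: G_def facility_cost_def l)
    then show ?thesis
      using Fle kmin[of l] gmin[OF \<open>g' \<in> P\<close>, of l] by (simp add: m_def)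
  qed
  have "min_facility_cost n x = facility_cost n x F"
    unfolding min_facility_cost_def using F opt by (intro cInf_eq_minimum) auto
  then show ?thesis
    using F opt by auto
qed

end

theory Submission
  imports Defs
begin

text \<open>
  Cut the unit square into \<open>k \<times> k\<close> cells with \<open>k = \<lceil>n powr (1/3)\<rceil>\<close>. Opening a facility at every grid
  vertex costs \<open>O(k\<^sup>2)\<close> and leaves every point within \<open>O(1/k)\<close> of a facility, which gives the
  upper bound deterministically.

  For the lower bound, a point in the concentric half-size core of a cell pays at least
  \<open>a = 1/(4k)\<close> unless its cell contains a facility. With \<open>N\<close> sample points in the core, the cell
  therefore accounts for a cost of at least \<open>min 1 (a N)\<close>, and \<open>min 1 t \<ge> t - t\<^sup>2/4\<close>. The
  expectation of \<open>a N - (a N)\<^sup>2/4\<close> needs only the first two moments of \<open>N\<close>, hence only pairwise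
  independence, and is of constant order for each of the \<open>k\<^sup>2\<close> cells.
\<close>

section \<open>Continuity and measurability of the optimal cost\<close>

lemma facility_cost_nonneg:
  assumes "F \<in> facility_sets"
  shows "0 \<le> facility_cost n x F"
proof -
  have "0 \<le> Min ((\<lambda>f. norm (x i - f)) ` F)" for i
    using assms by (subst Min_ge_iff) (auto simp: facility_sets_def)
  then show ?thesis
    unfolding facility_cost_def by (simp add: sum_nonneg)
qed

lemma min_facility_cost_nonneg: "0 \<le> min_facility_cost n x"
  by (metis facility_cost_nonneg min_facility_cost_attained)

lemma min_facility_cost_le:
  "F \<in> facility_sets \<Longrightarrow> min_facility_cost n x \<le> facility_cost n x F"
  by (metis min_facility_cost_attained)

text \<open>The facility of \<open>F\<close> nearest to \<open>y i\<close> also competes for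
  \<open>x i\<close>; the triangle inequality does the rest. The error term does not depend on
  \<open>F\<close>, so it survives minimisation over \<open>F\<close>.\<close>

lemma facility_cost_lipschitz:
  assumes "F \<in> facility_sets"
  shows "facility_cost n x F \<le> facility_cost n y F + (\<Sum>i = 1..n. norm (x i - y i))"
proof -
  have F: "finite F" "F \<noteq> {}"
    using assms by (auto simp: facility_sets_def)
  have "Min ((\<lambda>f. norm (x i - f)) ` F) \<le> Min ((\<lambda>f. norm (y i - f)) ` F) + norm (x i - y i)" for i
  proof -
    have "Min ((\<lambda>f. norm (y i - f)) ` F) \<in> (\<lambda>f. norm (y i - f)) ` F"
      using F by (intro Min_in) auto
    then obtain f where f: "f \<in> F" "Min ((\<lambda>f. norm (y i - f)) ` F) = norm (y i - f)"
      by auto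
    have "Min ((\<lambda>f. norm (x i - f)) ` F) \<le> norm (x i - f)"
      using F f by (intro Min_le) auto
    also have "\<dots> \<le> norm (y i - f) + norm (x i - y i)"
      using norm_triangle_ineq[of "y i - f" "x i - y i"] by simp
    finally show ?thesis using f by simp
  qed
  then have "(\<Sum>i = 1..n. Min ((\<lambda>f. norm (x i - f)) ` F))
      \<le> (\<Sum>i = 1..n. Min ((\<lambda>f. norm (y i - f)) ` F) + norm (x i - y i))"
    by (intro sum_mono)
  then show ?thesis
    by (simp add: facility_cost_def sum.distrib)
qed

text \<open>An optimal set for one configuration is a competitor for the other; exchanging the roles
  gives the absolute value.\<close>

lemma min_facility_cost_lipschitz:
  "\<bar>min_facility_cost n x - min_facility_cost n y\<bar> \<le> (\<Sum>i = 1..n. norm (x i - y i))"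
proof -
  have *: "min_facility_cost n x \<le> min_facility_cost n y + (\<Sum>i = 1..n. norm (x i - y i))" for x y
  proof -
    obtain F where F: "F \<in> facility_sets" "facility_cost n y F = min_facility_cost n y"
      using min_facility_cost_attained by blast
    then show ?thesis
      using min_facility_cost_le[OF F(1), of n x] facility_cost_lipschitz[OF F(1), of n x y] by simp
  qed
  show ?thesis
    using *[of x y] *[of y x] by (simp add: norm_minus_commute abs_le_iff)
qed

text \<open>Continuity is for the product topology on sequences. The Lipschitz bound involves
  finitely many coordinates only, so it is itself continuous and tends to 0.\<close>

lemma continuous_on_min_facility_cost: "continuous_on UNIV (min_facility_cost n)"
  unfolding continuous_on_def
proof (intro ballI)
  fix x :: "nat \<Rightarrow> real ^ 2"
  have "continuous_on UNIV (\<lambda>y :: nat \<Rightarrow> real ^ 2. \<Sum>i = 1..n. norm (y i - x i))"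
    by (intro continuous_intros continuous_on_product_coordinates)
  then have "((\<lambda>y. \<Sum>i = 1..n. norm (y i - x i)) \<longlongrightarrow> (\<Sum>i = 1..n. norm (x i - x i))) (at x)"
    unfolding continuous_on_def by blast
  then have *: "((\<lambda>y. \<Sum>i = 1..n. norm (y i - x i)) \<longlongrightarrow> 0) (at x)"
    by simp
  have "((\<lambda>y. min_facility_cost n y - min_facility_cost n x) \<longlongrightarrow> 0) (at x)"
    by (rule Lim_null_comparison[OF _ *]) (use min_facility_cost_lipschitz in auto)
  then show "(min_facility_cost n \<longlongrightarrow> min_facility_cost n x) (at x)"
    by (simp add: LIM_zero_iff)
qed

text \<open>The infimum runs over an uncountable family, so measurability cannot be taken over from
  the single costs. It comes from continuity, since the Borel sets of the countable product are the
  product sigma-algebra.\<close>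

lemma borel_measurable_min_facility_cost:
  assumes X: "\<And>i. i \<in> {1..n} \<Longrightarrow> X i \<in> borel_measurable M"
  shows "(\<lambda>\<omega>. min_facility_cost n (\<lambda>i. X i \<omega>)) \<in> borel_measurable M"
proof -
  \<comment> \<open>Coordinates outside \<open>{1..n}\<close> carry no measurability assumption.
    Setting them to 0 leaves the cost unchanged.\<close>
  define Y where "Y = (\<lambda>\<omega> i. if i \<in> {1..n} then X i \<omega> else 0)"
  have "(\<lambda>\<omega>. Y \<omega> i) \<in> borel_measurable M" for i
    using X[of i] by (cases "i \<in> {1..n}") (simp_all only: Y_def if_True if_False borel_measurable_const)
  then have "Y \<in> measurable M (Pi\<^sub>M UNIV (\<lambda>_. borel))"
    by (intro measurable_PiM_single') auto
  then have "Y \<in> measurable M borel"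
    by (simp add: measurable_cong_sets[OF refl sets_PiM_equal_borel])
  then have "(\<lambda>\<omega>. min_facility_cost n (Y \<omega>)) \<in> borel_measurable M"
    by (rule measurable_compose)
       (rule borel_measurable_continuous_onI[OF continuous_on_min_facility_cost])
  moreover have "min_facility_cost n (Y \<omega>) = min_facility_cost n (\<lambda>i. X i \<omega>)" for \<omega>
    by (simp add: min_facility_cost_def facility_cost_def Y_def cong: INF_cong)
  ultimately show ?thesis by simp
qed

section \<open>Facilities on a grid\<close>

lemma norm_vec2_le: "norm (z :: real ^ 2) \<le> \<bar>z $ 1\<bar> + \<bar>z $ 2\<bar>"
  using norm_le_l1_cart[of z] by (simp add: sum_2)

text \<open>The first term counts the grid vertices. Rounding both coordinates down gives a vertex
  off by at most \<open>1 / k\<close> in each, hence at distance at most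
  \<open>2 / k\<close>.\<close>

lemma min_facility_cost_le_grid:
  assumes k: "k > 0" and x: "\<And>i. i \<in> {1..n} \<Longrightarrow> x i \<in> unit_square"
  shows "min_facility_cost n x \<le> (real k + 1)\<^sup>2 + 2 * real n / real k"
proof -
  define p :: "nat \<times> nat \<Rightarrow> real ^ 2" where "p = (\<lambda>(u, v). vector [real u / real k, real v / real k])"
  define F where "F = p ` ({..k} \<times> {..k})"
  have F: "F \<in> facility_sets"
    using k by (auto simp: F_def facility_sets_def p_def unit_square_def mem_box_cart forall_2)
  have "card F \<le> card ({..k} \<times> {..k})"
    unfolding F_def by (rule card_image_le) simp
  then have card: "real (card F) \<le> (real k + 1)\<^sup>2"
    by (simp add: power2_eq_square add.commute flip: of_nat_Suc of_nat_mult)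
  have near: "\<exists>u\<le>k. \<bar>t - real u / real k\<bar> \<le> 1 / real k" if t: "0 \<le> t" "t \<le> 1" for t
  proof (intro exI conjI)
    \<comment> \<open>At \<open>t = 1\<close> this is \<open>k\<close> itself, so the grid needs
      \<open>k + 1\<close> values per axis.\<close>
    define u where "u = nat \<lfloor>real k * t\<rfloor>"
    have u: "real u \<le> real k * t" "real k * t \<le> real u + 1"
      using t by (simp_all add: u_def)
    have "real k * t \<le> real k" using t by (simp add: mult_left_le)
    then show "u \<le> k" using u by linarith
    have "t - real u / real k = (real k * t - real u) / real k"
      using k by (simp add: field_simps)
    then show "\<bar>t - real u / real k\<bar> \<le> 1 / real k"
      using u by (simp add: divide_right_mono)
  qed
  have "Min ((\<lambda>f. norm (x i - f)) ` F) \<le> 2 / real k" if i: "i \<in> {1..n}" for i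
  proof -
    have "0 \<le> x i $ 1" "x i $ 1 \<le> 1" "0 \<le> x i $ 2" "x i $ 2 \<le> 1"
      using x[OF i] by (auto simp: unit_square_def mem_box_cart)
    then obtain u v where uv: "u \<le> k" "v \<le> k"
      "\<bar>x i $ 1 - real u / real k\<bar> \<le> 1 / real k" "\<bar>x i $ 2 - real v / real k\<bar> \<le> 1 / real k"
      using near by metis
    have "Min ((\<lambda>f. norm (x i - f)) ` F) \<le> norm (x i - p (u, v))"
      using uv by (intro Min_le) (auto simp: F_def)
    also have "\<dots> \<le> \<bar>x i $ 1 - real u / real k\<bar> + \<bar>x i $ 2 - real v / real k\<bar>"
      using norm_vec2_le[of "x i - p (u, v)"] by (simp add: p_def)
    also have "\<dots> \<le> 2 / real k" using uv by simp
    finally show ?thesis .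
  qed
  then have "(\<Sum>i = 1..n. Min ((\<lambda>f. norm (x i - f)) ` F)) \<le> (\<Sum>i = 1..n. 2 / real k)"
    by (intro sum_mono)
  then have "facility_cost n x F \<le> (real k + 1)\<^sup>2 + 2 * real n / real k"
    using card by (simp add: facility_cost_def mult.commute)
  then show ?thesis using min_facility_cost_le[OF F, of n x] by simp
qed

section \<open>Cells and their cores\<close>

text \<open>The half-open cells partition the whole plane, so each facility belongs to exactly one
  of them. A facility on the right or upper edge of the square gets an index outside
  \<open>cell_indices k\<close>.\<close>

definition cell_index :: "nat \<Rightarrow> real ^ 2 \<Rightarrow> int \<times> int" where
  "cell_index k z = (\<lfloor>real k * z $ 1\<rfloor>, \<lfloor>real k * z $ 2\<rfloor>)"

text \<open>After scaling by \<open>k\<close> the core keeps a margin of 1/4 to every side of its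
  cell.\<close>

definition cell_core :: "nat \<Rightarrow> int \<times> int \<Rightarrow> (real ^ 2) set" where
  "cell_core k q =
     cbox (vector [(of_int (fst q) + 1/4) / real k, (of_int (snd q) + 1/4) / real k])
          (vector [(of_int (fst q) + 3/4) / real k, (of_int (snd q) + 3/4) / real k])"

definition cell_indices :: "nat \<Rightarrow> (int \<times> int) set" where
  "cell_indices k = {0..<int k} \<times> {0..<int k}"

lemma finite_cell_indices [simp]: "finite (cell_indices k)"
  by (simp add: cell_indices_def)

lemma card_cell_indices [simp]: "card (cell_indices k) = k\<^sup>2"
  by (simp add: cell_indices_def power2_eq_square)

lemma mem_cell_core:
  assumes "k > 0"
  shows "z \<in> cell_core k q \<longleftrightarrow>
    of_int (fst q) + 1/4 \<le> real k * z $ 1 \<and> real k * z $ 1 \<le> of_int (fst q) + 3/4 \<and>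
    of_int (snd q) + 1/4 \<le> real k * z $ 2 \<and> real k * z $ 2 \<le> of_int (snd q) + 3/4"
  using assms by (auto simp: cell_core_def mem_box_cart forall_2 field_simps)

lemma cell_index_core:
  assumes "k > 0" "z \<in> cell_core k q"
  shows "cell_index k z = q"
proof -
  have "\<lfloor>real k * z $ 1\<rfloor> = fst q" "\<lfloor>real k * z $ 2\<rfloor> = snd q"
    using assms by (auto simp: mem_cell_core floor_eq_iff)
  then show ?thesis by (simp add: cell_index_def)
qed

text \<open>Lying in another cell means a different floor in some coordinate. The margin of the core
  then forces a scaled gap of at least 1/4 there, and a coordinate difference is at most the
  norm.\<close>

lemma dist_cell_core:
  assumes k: "k > 0" and z: "z \<in> cell_core k q" and f: "cell_index k f \<noteq> q"
  shows "1 / (4 * real k) \<le> norm (z - f)"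
proof -
  have aux: "1/4 \<le> \<bar>s - t\<bar>" if "of_int m + 1/4 \<le> s" "s \<le> of_int m + 3/4" "\<lfloor>t\<rfloor> \<noteq> m"
    for s t :: real and m :: int
  proof -
    have "t < of_int m \<or> of_int m + 1 \<le> t"
      using that(3) by linarith
    then show ?thesis using that by linarith
  qed
  have "\<lfloor>real k * f $ 1\<rfloor> \<noteq> fst q \<or> \<lfloor>real k * f $ 2\<rfloor> \<noteq> snd q"
    using f by (auto simp: cell_index_def prod_eq_iff)
  then have "1/4 \<le> \<bar>real k * z $ 1 - real k * f $ 1\<bar> \<or> 1/4 \<le> \<bar>real k * z $ 2 - real k * f $ 2\<bar>"
    using z aux by (auto simp: mem_cell_core[OF k])
  moreover have "\<bar>real k * z $ j - real k * f $ j\<bar> \<le> real k * norm (z - f)" for j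
    using component_le_norm_cart[of "z - f" j]
    by (simp add: abs_mult mult_left_mono flip: right_diff_distrib)
  ultimately have "1/4 \<le> real k * norm (z - f)"
    by (meson order_trans)
  then show ?thesis using k by (simp add: field_simps)
qed

lemma cell_core_subset_unit_square:
  assumes k: "k > 0" and q: "q \<in> cell_indices k"
  shows "cell_core k q \<subseteq> unit_square"
proof
  fix z assume z: "z \<in> cell_core k q"
  have "fst q \<ge> 0" "fst q + 1 \<le> int k" "snd q \<ge> 0" "snd q + 1 \<le> int k"
    using q by (auto simp: cell_indices_def)
  then have "real_of_int (fst q) \<ge> 0" "real_of_int (fst q) + 1 \<le> real k"
    "real_of_int (snd q) \<ge> 0" "real_of_int (snd q) + 1 \<le> real k"
    by linarith+
  then have "0 \<le> real k * z $ j \<and> real k * z $ j \<le> real k" for j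
    using z exhaust_2[of j] unfolding mem_cell_core[OF k] by (elim disjE; hypsubst) linarith+
  then show "z \<in> unit_square"
    using k by (simp add: unit_square_def mem_box_cart zero_le_mult_iff)
qed

lemma measure_cell_core:
  assumes "k > 0"
  shows "measure lborel (cell_core k q) = 1 / (4 * (real k)\<^sup>2)"
proof -
  have "measure lborel (cell_core k q) = (3 / (4 * real k) - 1 / (4 * real k))\<^sup>2"
    using assms unfolding cell_core_def
    by (subst content_cbox_cart)
       (auto simp: interval_ne_empty_cart forall_2 prod_2 UNIV_2
         divide_right_mono power2_eq_square field_simps)
  then show ?thesis
    using assms by (simp add: power2_eq_square field_simps)
qed

text \<open>A charging argument for an optimal \<open>F\<close>: each facility pays 1 to its own
  cell, and each sample point in the core of a cell without facility pays \<open>a\<close> to that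
  cell. Nobody pays twice, so the cells collect at most the cost. The quadratic stands in for a cap
  at 1, so that two moments suffice later.\<close>

lemma min_facility_cost_ge_cells:
  fixes x :: "nat \<Rightarrow> real ^ 2" and n :: nat
  assumes k: "k > 0"
  defines "a \<equiv> 1 / (4 * real k)"
  defines "N \<equiv> \<lambda>q. (\<Sum>i = 1..n. indicator (cell_core k q) (x i) :: real)"
  shows "(\<Sum>q\<in>cell_indices k. a * N q - (a * N q)\<^sup>2 / 4) \<le> min_facility_cost n x"
proof -
  obtain F where F: "F \<in> facility_sets" "facility_cost n x F = min_facility_cost n x"
    using min_facility_cost_attained by blast
  have fin: "finite F" "F \<noteq> {}"
    using F by (auto simp: facility_sets_def)
  define S where "S = cell_index k ` F"
  \<comment> \<open>\<open>e q\<close> is 1 exactly when cell \<open>q\<close> has no facility;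
    \<open>1 - e q\<close> is what facilities pay to \<open>q\<close>, and
    \<open>a * N q * e q\<close> is what points pay.\<close>
  define e where "e = (\<lambda>q. if q \<in> S then 0 else 1 :: real)"
  have "card (cell_indices k \<inter> S) \<le> card F"
    using fin by (metis S_def card_image_le card_mono finite_imageI inf_le2 order_trans)
  moreover have "(\<Sum>q\<in>cell_indices k. 1 - e q) = (\<Sum>q\<in>cell_indices k. if q \<in> S then 1 else 0)"
    by (intro sum.cong) (auto simp: e_def)
  ultimately have card: "(\<Sum>q\<in>cell_indices k. 1 - e q) \<le> real (card F)"
    by (simp add: sum.If_cases Collect_mem_eq)
  have pay: "(\<Sum>q\<in>cell_indices k. a * indicator (cell_core k q) (x i) * e q)
      \<le> Min ((\<lambda>f. norm (x i - f)) ` F)" for i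
  proof -
    define r where "r = cell_index k (x i)"
    \<comment> \<open>Cores of different cells are disjoint, so only the cell \<open>r\<close> of
      \<open>x i\<close> can contribute. If \<open>r\<close> is outside
      \<open>cell_indices k\<close>, the sum is 0 and the bound by the term for \<open>r\<close>
      still holds.\<close>
    have zero: "indicator (cell_core k q) (x i) = (0 :: real)" if "q \<noteq> r" for q
      using that cell_index_core[OF k, of "x i" q] by (auto simp: r_def indicator_def)
    have "(\<Sum>q\<in>cell_indices k. a * indicator (cell_core k q) (x i) * e q)
        = (\<Sum>q\<in>cell_indices k. if q = r then a * indicator (cell_core k r) (x i) * e r else 0)"
      by (intro sum.cong) (auto simp: zero)
    also have "\<dots> \<le> a * indicator (cell_core k r) (x i) * e r"
      by (auto simp: a_def e_def)
    also have "\<dots> \<le> norm (x i - f)" if "f \<in> F" for f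
    proof (cases "x i \<in> cell_core k r \<and> r \<notin> S")
      case True
      then have "cell_index k f \<noteq> r"
        using that by (auto simp: S_def)
      then show ?thesis
        using True dist_cell_core[OF k, of "x i" r f] by (simp add: a_def e_def)
    qed (auto simp: e_def)
    ultimately show ?thesis
      using fin by (subst Min_ge_iff) force+
  qed
  have "a * N q - (a * N q)\<^sup>2 / 4 \<le> (1 - e q) + a * N q * e q" for q
  proof -
    \<comment> \<open>This settles cells with a facility, where the right-hand side is 1. For the
      others it is \<open>a * N q\<close>, and the square is simply dropped.\<close>
    have "a * N q - (a * N q)\<^sup>2 / 4 \<le> 1"
      using zero_le_power2[of "1 - a * N q / 2"] by (simp add: power2_eq_square field_simps)
    then show ?thesis by (auto simp: e_def)
  qed
  then have "(\<Sum>q\<in>cell_indices k. a * N q - (a * N q)\<^sup>2 / 4)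
      \<le> (\<Sum>q\<in>cell_indices k. (1 - e q) + a * N q * e q)"
    by (intro sum_mono)
  also have "\<dots> = (\<Sum>q\<in>cell_indices k. 1 - e q)
      + (\<Sum>i = 1..n. \<Sum>q\<in>cell_indices k. a * indicator (cell_core k q) (x i) * e q)"
    by (subst sum.swap)
       (simp only: N_def sum.distrib sum_distrib_left sum_distrib_right)
  also have "\<dots> \<le> facility_cost n x F"
    unfolding facility_cost_def by (intro add_mono sum_mono card pay)
  finally show ?thesis using F by simp
qed

section \<open>Moments of the cell counts\<close>

lemma (in prob_space) expectation_count:
  assumes X: "\<And>i. i \<in> {1..n} \<Longrightarrow> X i \<in> borel_measurable M"
    and p: "\<And>i. i \<in> {1..n} \<Longrightarrow> prob (X i -` A \<inter> space M) = p"
    and A: "A \<in> sets borel"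
  shows "expectation (\<lambda>\<omega>. \<Sum>i = 1..n. indicator A (X i \<omega>) :: real) = real n * p"
proof -
  have S: "X i -` A \<inter> space M \<in> events" if "i \<in> {1..n}" for i
    using X[OF that] A by (rule measurable_sets)
  have "expectation (\<lambda>\<omega>. \<Sum>i = 1..n. indicator A (X i \<omega>) :: real)
      = expectation (\<lambda>\<omega>. \<Sum>i = 1..n. indicator (X i -` A \<inter> space M) \<omega> :: real)"
    by (intro Bochner_Integration.integral_cong sum.cong) (auto simp: indicator_def)
  also have "\<dots> = (\<Sum>i = 1..n. prob (X i -` A \<inter> space M))"
    using S by (subst Bochner_Integration.integral_sum) (auto simp: emeasure_eq_measure)
  also have "\<dots> = real n * p"
    using p by simp
  finally show ?thesis .
qed

text \<open>The square expands into probabilities of pairwise intersections: \<open>p\<close> on the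
  diagonal and, by independence, \<open>p\<^sup>2\<close> off it.\<close>

lemma (in prob_space) expectation_count_square_le:
  assumes indep: "indep_vars (\<lambda>_. borel) X {1..n}"
    and p: "\<And>i. i \<in> {1..n} \<Longrightarrow> prob (X i -` A \<inter> space M) = p"
    and A: "A \<in> sets borel"
  shows "expectation (\<lambda>\<omega>. (\<Sum>i = 1..n. indicator A (X i \<omega>) :: real)\<^sup>2)
    \<le> (real n * p)\<^sup>2 + real n * p"
proof -
  define B where "B = (\<lambda>i. X i -` A \<inter> space M)"
  have S: "B i \<in> events" if "i \<in> {1..n}" for i
    unfolding B_def using indep that A by (intro measurable_sets) (auto simp: indep_vars_def)
  \<comment> \<open>On the diagonal \<open>p\<^sup>2\<close> is pure slack; it makes the double sum
    collapse to a simple expression.\<close>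
  have pair: "prob (B i \<inter> B j) \<le> p\<^sup>2 + (if j = i then p else 0)"
    if ij: "i \<in> {1..n}" "j \<in> {1..n}" for i j
  proof (cases "j = i")
    case True
    then show ?thesis using p[OF ij(1)] by (simp add: B_def)
  next
    case False
    have "prob (\<Inter>l\<in>{i, j}. X l -` A \<inter> space M) = (\<Prod>l\<in>{i, j}. prob (X l -` A \<inter> space M))"
      using ij A by (intro indep_varsD[OF indep]) auto
    then show ?thesis
      using False p[OF ij(1)] p[OF ij(2)] by (simp add: B_def power2_eq_square)
  qed
  have "expectation (\<lambda>\<omega>. (\<Sum>i = 1..n. indicator A (X i \<omega>) :: real)\<^sup>2)
      = expectation (\<lambda>\<omega>. \<Sum>i = 1..n. \<Sum>j = 1..n. indicator (B i \<inter> B j) \<omega> :: real)"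
    unfolding power2_eq_square sum_product
    by (intro Bochner_Integration.integral_cong sum.cong) (auto simp: indicator_def B_def)
  also have "\<dots> = (\<Sum>i = 1..n. \<Sum>j = 1..n. prob (B i \<inter> B j))"
    using S by (subst Bochner_Integration.integral_sum)
      (auto simp: emeasure_eq_measure Bochner_Integration.integral_sum
        intro!: Bochner_Integration.integrable_sum sum.cong)
  also have "\<dots> \<le> (\<Sum>i = 1..n. \<Sum>j = 1..n. p\<^sup>2 + (if j = i then p else 0))"
    by (intro sum_mono pair)
  also have "\<dots> = (\<Sum>i = 1..n. real n * p\<^sup>2 + p)"
    by (intro sum.cong) (simp_all add: sum.distrib)
  also have "\<dots> = (real n * p)\<^sup>2 + real n * p"
    by (simp add: power2_eq_square algebra_simps)
  finally show ?thesis .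
qed

section \<open>Bounds on the expected cost\<close>

lemma measure_unit_square: "measure lborel unit_square = 1"
  unfolding unit_square_def
  by (subst content_cbox_cart) (auto simp: interval_ne_empty_cart)

lemma emeasure_unit_square: "emeasure lborel unit_square = 1"
  using measure_unit_square emeasure_eq_ennreal_measure[of lborel unit_square]
    emeasure_lborel_cbox_finite[of "0 :: real ^ 2" 1]
  by (simp add: unit_square_def less_top)

lemma (in prob_space) prob_uniform_unit_square:
  assumes X: "X \<in> borel_measurable M"
    and d: "distr M borel X = uniform_measure lborel unit_square"
    and A: "A \<in> sets borel" "A \<subseteq> unit_square"
  shows "prob (X -` A \<inter> space M) = measure lborel A"
proof -
  have "prob (X -` A \<inter> space M) = measure (uniform_measure lborel unit_square) A"
    using measure_distr[OF X A(1)] d by simp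
  also have "\<dots> = measure lborel A"
    using A by (simp add: measure_uniform_measure emeasure_unit_square measure_unit_square Int_absorb1)
  finally show ?thesis .
qed

text \<open>The bounds are kept in terms of any \<open>k\<close> with \<open>n \<le> k ^ 3\<close>,
  apart from the rounding of the cube root.\<close>

lemma (in prob_space) expected_min_facility_cost_bounds:
  assumes indep: "indep_vars (\<lambda>_. borel) X {1..n}"
    and d: "\<And>i. i \<in> {1..n} \<Longrightarrow> distr M borel (X i) = uniform_measure lborel unit_square"
    and k: "k > 0" "real n \<le> real k ^ 3"
  shows "real n / (32 * real k) \<le> expectation (\<lambda>\<omega>. min_facility_cost n (\<lambda>i. X i \<omega>))" (is ?lower)
    and "expectation (\<lambda>\<omega>. min_facility_cost n (\<lambda>i. X i \<omega>)) \<le> (real k + 1)\<^sup>2 + 2 * real n / real k"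
      (is ?upper)
proof -
  have X: "X i \<in> borel_measurable M" if "i \<in> {1..n}" for i
    using indep that by (auto simp: indep_vars_def)
  have "AE \<omega> in M. X i \<omega> \<in> unit_square" if i: "i \<in> {1..n}" for i
  proof -
    have "prob (X i -` unit_square \<inter> space M) = 1"
      using prob_uniform_unit_square[OF X[OF i] d[OF i], of unit_square]
      by (simp add: measure_unit_square) (simp add: unit_square_def)
    from AE_prob_1[OF this] show ?thesis by auto
  qed
  then have "AE \<omega> in M. \<forall>i\<in>{1..n}. X i \<omega> \<in> unit_square"
    by (simp add: AE_finite_all)
  \<comment> \<open>The grid bound requires points in the square, which is known only almost surely.
    Together with nonnegativity it also yields integrability.\<close>
  then have le: "AE \<omega> in M. min_facility_cost n (\<lambda>i. X i \<omega>) \<le> (real k + 1)\<^sup>2 + 2 * real n / real k"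
    by eventually_elim (rule min_facility_cost_le_grid[OF k(1)], simp)
  have int: "integrable M (\<lambda>\<omega>. min_facility_cost n (\<lambda>i. X i \<omega>))"
    by (rule integrable_const_bound[OF _ borel_measurable_min_facility_cost[OF X]])
       (use le min_facility_cost_nonneg in auto)
  show ?upper
    by (rule integral_le_const[OF int le])

  define a where "a = 1 / (4 * real k)"
  define p where "p = 1 / (4 * (real k)\<^sup>2)"
  define N where "N = (\<lambda>q \<omega>. \<Sum>i = 1..n. indicator (cell_core k q) (X i \<omega>) :: real)"
  have core: "cell_core k q \<in> sets borel" for q
    by (simp add: cell_core_def)
  have prob: "prob (X i -` cell_core k q \<inter> space M) = p"
    if "q \<in> cell_indices k" "i \<in> {1..n}" for q i
    using prob_uniform_unit_square[OF X d core cell_core_subset_unit_square] that k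
    by (simp add: measure_cell_core p_def)
  have N_meas: "N q \<in> borel_measurable M" for q
    unfolding N_def
    by (intro borel_measurable_sum measurable_compose[OF X borel_measurable_indicator[OF core]])
  have N_bound: "0 \<le> N q \<omega> \<and> N q \<omega> \<le> real n" for q \<omega>
  proof -
    have "N q \<omega> \<le> (\<Sum>i = 1..n. 1)"
      unfolding N_def by (intro sum_mono) (simp add: indicator_def)
    then show ?thesis by (simp add: N_def sum_nonneg)
  qed
  have N_int: "integrable M (N q)" "integrable M (\<lambda>\<omega>. (N q \<omega>)\<^sup>2)" for q
  proof -
    show "integrable M (N q)"
      using N_bound N_meas by (intro integrable_const_bound[where B = "real n"]) auto
    show "integrable M (\<lambda>\<omega>. (N q \<omega>)\<^sup>2)"
      using N_bound N_meas by (intro integrable_const_bound[where B = "(real n)\<^sup>2"]) (auto intro: power_mono)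
  qed
  \<comment> \<open>\<open>t\<close> is the mean of \<open>a * N q\<close> for a cell of the square.
    The assumption on \<open>k\<close> keeps it at most 1/16, so \<open>t * t \<le> t\<close>; the
    second moment is then at most \<open>2 * t\<close>, and a quarter of it takes away at most half
    of the mean.\<close>
  define t where "t = a * (real n * p)"
  have t: "t = real n / real k ^ 3 / 16"
    by (simp add: t_def a_def p_def power2_eq_square power3_eq_cube)
  have "t \<ge> 0" "t \<le> 1 / 16"
    using k by (auto simp: t)
  have "a \<le> 1"
    using k by (simp add: a_def)
  have cell: "t / 2 \<le> expectation (\<lambda>\<omega>. a * N q \<omega> - (a * N q \<omega>)\<^sup>2 / 4)"
    if q: "q \<in> cell_indices k" for q
  proof -
    have E1: "expectation (N q) = real n * p"
      unfolding N_def using expectation_count[OF X prob[OF q] core] .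
    have E2: "expectation (\<lambda>\<omega>. (N q \<omega>)\<^sup>2) \<le> (real n * p)\<^sup>2 + real n * p"
      unfolding N_def using expectation_count_square_le[OF indep prob[OF q] core] .
    have "a\<^sup>2 * expectation (\<lambda>\<omega>. (N q \<omega>)\<^sup>2) \<le> a\<^sup>2 * ((real n * p)\<^sup>2 + real n * p)"
      using E2 by (intro mult_left_mono) auto
    also have "\<dots> = t * t + a * t"
      by (simp add: t_def power2_eq_square algebra_simps)
    also have "\<dots> \<le> 1 * t + 1 * t"
      using \<open>t \<ge> 0\<close> \<open>t \<le> 1 / 16\<close> \<open>a \<le> 1\<close> by (intro add_mono mult_right_mono) auto
    finally have sq: "a\<^sup>2 * expectation (\<lambda>\<omega>. (N q \<omega>)\<^sup>2) \<le> 2 * t"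
      by simp
    have "expectation (\<lambda>\<omega>. a * N q \<omega> - (a * N q \<omega>)\<^sup>2 / 4)
        = a * expectation (N q) - a\<^sup>2 * expectation (\<lambda>\<omega>. (N q \<omega>)\<^sup>2) / 4"
      using N_int by (simp add: power_mult_distrib)
    then show ?thesis
      using sq by (simp add: E1 flip: t_def)
  qed
  \<comment> \<open>There are \<open>k\<^sup>2\<close> cells, each contributing
    \<open>t / 2 = n / (32 * k ^ 3)\<close>.\<close>
  have "real n / (32 * real k) = (\<Sum>q\<in>cell_indices k. t / 2)"
    using k by (simp add: t power2_eq_square power3_eq_cube field_simps)
  also have "\<dots> \<le> (\<Sum>q\<in>cell_indices k. expectation (\<lambda>\<omega>. a * N q \<omega> - (a * N q \<omega>)\<^sup>2 / 4))"
    by (intro sum_mono cell)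
  also have "\<dots> = expectation (\<lambda>\<omega>. \<Sum>q\<in>cell_indices k. a * N q \<omega> - (a * N q \<omega>)\<^sup>2 / 4)"
    using N_int by (subst Bochner_Integration.integral_sum) (auto simp: power_mult_distrib)
  also have "\<dots> \<le> expectation (\<lambda>\<omega>. min_facility_cost n (\<lambda>i. X i \<omega>))"
  proof (rule integral_mono[OF _ int])
    show "integrable M (\<lambda>\<omega>. \<Sum>q\<in>cell_indices k. a * N q \<omega> - (a * N q \<omega>)\<^sup>2 / 4)"
      using N_int by (auto simp: power_mult_distrib)
    show "(\<Sum>q\<in>cell_indices k. a * N q \<omega> - (a * N q \<omega>)\<^sup>2 / 4) \<le> min_facility_cost n (\<lambda>i. X i \<omega>)" for \<omega>
      unfolding N_def a_def by (rule min_facility_cost_ge_cells[OF k(1)])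
  qed
  finally show ?lower .
qed

theorem theorem2p5:
  shows "\<exists>c > 0. \<exists>C > 0. \<exists>N :: nat. \<forall>n \<ge> N. \<forall>(M :: 'a measure) (X :: nat \<Rightarrow> 'a \<Rightarrow> real ^ 2).
    prob_space M \<longrightarrow>
    prob_space.indep_vars M (\<lambda>_. borel) X {1..n} \<longrightarrow>
    (\<forall>i \<in> {1..n}. distr M borel (X i) = uniform_measure lborel unit_square) \<longrightarrow>
    c * real n powr (2 / 3) \<le> prob_space.expectation M (\<lambda>\<omega>. min_facility_cost n (\<lambda>i. X i \<omega>)) \<and>
    prob_space.expectation M (\<lambda>\<omega>. min_facility_cost n (\<lambda>i. X i \<omega>)) \<le> C * real n powr (2 / 3)"
proof (rule exI[of _ "1/64"], intro conjI, simp, rule exI[of _ 11], intro conjI, simp,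
    rule exI[of _ 1], intro allI impI)
  fix n :: nat and M :: "'a measure" and X :: "nat \<Rightarrow> 'a \<Rightarrow> real ^ 2"
  assume n: "n \<ge> 1" and M: "prob_space M"
    and indep: "prob_space.indep_vars M (\<lambda>_. borel) X {1..n}"
    and d: "\<forall>i \<in> {1..n}. distr M borel (X i) = uniform_measure lborel unit_square"
  interpret prob_space M by (fact M)
  define r where "r = real n powr (1/3)"
  have r1: "r \<ge> 1"
    using n by (simp add: r_def ge_one_powr_ge_zero)
  have r2: "real n powr (2/3) = r\<^sup>2"
    using n by (simp add: r_def power2_eq_square flip: powr_add)
  have r3: "real n = r ^ 3"
    using n by (simp add: r_def power3_eq_cube flip: powr_add)
  \<comment> \<open>Since \<open>r \<ge> 1\<close>, rounding up at most doubles
    \<open>r\<close>.\<close>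
  define k where "k = nat \<lceil>r\<rceil>"
  have kr: "r \<le> real k" "real k \<le> 2 * r"
    using r1 unfolding k_def by linarith+
  have k: "k > 0" "real n \<le> real k ^ 3"
    using kr r1 by (auto simp: r3 intro!: power_mono)
  note bounds = expected_min_facility_cost_bounds[OF indep _ k]
  \<comment> \<open>\<open>64 = 32 * 2\<close>, the factor 2 coming from
    \<open>k \<le> 2 * r\<close>.\<close>
  have "1/64 * real n powr (2/3) = real n / (32 * (2 * r))"
    using r1 unfolding r2 unfolding r3 by (simp add: power2_eq_square power3_eq_cube)
  also have "\<dots> \<le> real n / (32 * real k)"
    using kr k(1) by (intro divide_left_mono) auto
  also have "\<dots> \<le> expectation (\<lambda>\<omega>. min_facility_cost n (\<lambda>i. X i \<omega>))"
    using d by (intro bounds) auto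
  finally have lower: "1/64 * real n powr (2/3) \<le> expectation (\<lambda>\<omega>. min_facility_cost n (\<lambda>i. X i \<omega>))" .
  have "expectation (\<lambda>\<omega>. min_facility_cost n (\<lambda>i. X i \<omega>)) \<le> (real k + 1)\<^sup>2 + 2 * real n / real k"
    using d by (intro bounds) auto
  \<comment> \<open>\<open>k + 1 \<le> 3 * r\<close> and \<open>n / r = r\<^sup>2\<close>, which
    gives the constant \<open>11 = 9 + 2\<close>.\<close>
  also have "\<dots> \<le> (3 * r)\<^sup>2 + 2 * real n / r"
    using kr r1 by (intro add_mono power_mono divide_left_mono) auto
  also have "\<dots> = 11 * real n powr (2/3)"
    using r1 unfolding r2 unfolding r3 by (simp add: power2_eq_square power3_eq_cube)
  finally show "1/64 * real n powr (2/3) \<le> expectation (\<lambda>\<omega>. min_facility_cost n (\<lambda>i. X i \<omega>)) \<and>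
      expectation (\<lambda>\<omega>. min_facility_cost n (\<lambda>i. X i \<omega>)) \<le> 11 * real n powr (2/3)"
    using lower by simp
qed

end
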